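(* Let $S \neq \mathbb{N}$ be a numerical semigroup with maximal ideal $M = S\setminus\{0\}$, let $a \in \mathbb{N}$ with $a \in M-2M$, and let $T = S+a$ be the dilatation of $S$ with respect to $a$. Then: \begin{enumerate} \item $F(T)=F(S)+a$; \item $g(T)=g(S)+a$; \item $e(T)=e(S)+a$; \item $n(T)=n(S)$; \item $t(T)=t(S)+a$; \item $H_T(h)=H_S(h)+a$ for each integer $h \geq 1$; \item $\nu(T)=\nu(S)+a$. \end{enumerate}
   Context: $\mathbb{N}$ denotes the nonnegative integers. A numerical semigroup $S$ is a submonoid of $(\mathbb{N},+)$ with $\mathbb{N}\setminus S$ finite; its maximal ideal is $M=S\setminus\{0\}$. For sets of integers $A,B$, put $A-B=\{z\in\mathbb{Z} : z+B\subseteq A\}$; for an integer $h\ge 1$, $hA$ is the $h$-fold sumset $\{x_1+\dots+x_h : x_i\in A\}$. So $a\in M-2M$ means $a+s_1+s_2\in M$ for all $s_1,s_2\in M$. For such $a\in\mathbb{N}$, the dilatation of $S$ with respect to $a$ is the numerical semigroup $S+a=\{0\}\cup\{s+a : s\in M\}$ (so here $S+a$ is not the full translate of $S$); its maximal ideal is $M+a=\{s+a: s\in M\}$. Invariants of a numerical semigroup $S\ne\mathbb{N}$ with maximal ideal $M$: the genus $g(S)=|\mathbb{N}\setminus S|$; the Frobenius number $F(S)=\max(\mathbb{N}\setminus S)$; the multiplicity $e(S)=\min M$; $n(S)=|S\cap[0,F(S)]|$; the type $t(S)=|(M-M)\setminus S|$; the embedding dimension $\nu(S)$, the cardinality of the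 unique minimal set of generators of $S$ as a monoid; the Hilbert function $H_S(h)=|hM\setminus(h+1)M|$ for $h\ge 1$. *)

theory Defs
  imports Complex_Main
begin

definition submonoid_nat :: "nat set \<Rightarrow> bool" where
  "submonoid_nat S \<longleftrightarrow> 0 \<in> S \<and> (\<forall>x\<in>S. \<forall>y\<in>S. x + y \<in> S)"

definition numerical_semigroup :: "nat set \<Rightarrow> bool" where
  "numerical_semigroup S \<longleftrightarrow> submonoid_nat S \<and> finite (- S)"

definition max_ideal :: "nat set \<Rightarrow> nat set" where
  "max_ideal S = S - {0}"

text \<open>The difference \<open>A - B = {z. z + B \<subseteq> A}\<close> is taken in the integers, as \<open>z\<close> may be negative;
  it is unrelated to the set-theoretic difference \<open>A - B\<close> of HOL. Sets of naturals enter it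
  through \<open>int ` _\<close>.\<close>

definition int_diff :: "int set \<Rightarrow> int set \<Rightarrow> int set" where
  "int_diff A B = {z. (+) z ` B \<subseteq> A}"

definition nfold_sumset :: "nat \<Rightarrow> nat set \<Rightarrow> nat set" where
  "nfold_sumset h A = {(\<Sum>i<h. x i) | x. \<forall>i<h. x i \<in> A}"

definition dilatation :: "nat set \<Rightarrow> nat \<Rightarrow> nat set" where
  "dilatation S a = {0} \<union> {s + a | s. s \<in> max_ideal S}"

definition genus :: "nat set \<Rightarrow> nat" where
  "genus S = card (- S)"

text \<open>Only meaningful for \<open>S \<noteq> UNIV\<close>, as \<open>Max {}\<close> is unspecified.\<close>

definition frobenius_number :: "nat set \<Rightarrow> nat" where
  "frobenius_number S = Max (- S)"

definition semigroup_multiplicity :: "nat set \<Rightarrow> nat" where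
  "semigroup_multiplicity S = (LEAST m. m \<in> max_ideal S)"

definition num_sporadic :: "nat set \<Rightarrow> nat" where
  "num_sporadic S = card (S \<inter> {0..frobenius_number S})"

definition semigroup_type :: "nat set \<Rightarrow> nat" where
  "semigroup_type S =
     card (int_diff (int ` max_ideal S) (int ` max_ideal S) - int ` S)"

definition minimal_generators :: "nat set \<Rightarrow> nat set \<Rightarrow> bool" where
  "minimal_generators S G \<longleftrightarrow>
     submonoid_nat hull G = S \<and> (\<forall>H. H \<subset> G \<longrightarrow> submonoid_nat hull H \<noteq> S)"

definition embedding_dimension :: "nat set \<Rightarrow> nat" where
  "embedding_dimension S = card (THE G. minimal_generators S G)"

definition hilbert_function :: "nat set \<Rightarrow> nat \<Rightarrow> nat" where
  "hilbert_function S h =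
     card (nfold_sumset h (max_ideal S) - nfold_sumset (h + 1) (max_ideal S))"

lemma submonoid_nat_hull: "submonoid_nat (submonoid_nat hull G)"
  by (rule hull_in) (auto simp: submonoid_nat_def)

text \<open>The definite description in \<^const>\<open>embedding_dimension\<close> is well defined: the minimal
  generators are the nonzero elements that are not sums of two nonzero elements.\<close>

lemma ex1_minimal_generators:
  assumes S: "submonoid_nat S"
  shows "\<exists>!G. minimal_generators S G"
proof -
  define A where
    "A = {s \<in> max_ideal S. \<forall>x\<in>max_ideal S. \<forall>y\<in>max_ideal S. s \<noteq> x + y}"
  have AS: "A \<subseteq> S" by (auto simp: A_def max_ideal_def)
  have gen: "submonoid_nat hull A = S"
  proof
    show "submonoid_nat hull A \<subseteq> S"
      using AS S by (rule hull_minimal)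
    have "s \<in> S \<longrightarrow> s \<in> submonoid_nat hull A" for s
    proof (induction s rule: less_induct)
      case (less s)
      consider "s = 0" | "s \<in> A"
        | x y where "x \<in> max_ideal S" "y \<in> max_ideal S" "s = x + y"
        | "s \<notin> S"
        unfolding A_def max_ideal_def by blast
      then show ?case
      proof cases
        case 1
        then show ?thesis using submonoid_nat_hull[of A] unfolding submonoid_nat_def [of "_ hull _"] by blast
      next
        case 2
        then show ?thesis by (simp add: hull_inc)
      next
        case 3
        then have "x \<in> submonoid_nat hull A" "y \<in> submonoid_nat hull A"
          using less.IH[of x] less.IH[of y] by (auto simp: max_ideal_def)
        then show ?thesis using 3(3) submonoid_nat_hull[of A] unfolding submonoid_nat_def [of "_ hull _"] by blast
      qed auto
    qed
    then show "S \<subseteq> submonoid_nat hull A" by blast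
  qed
  have sub: "A \<subseteq> G" if G: "submonoid_nat hull G = S" for G
  proof
    fix s assume s: "s \<in> A"
    show "s \<in> G"
    proof (rule ccontr)
      assume "s \<notin> G"
      moreover have "G \<subseteq> S" using G hull_subset by metis
      ultimately have "G \<subseteq> S - {s}" by blast
      moreover have "submonoid_nat (S - {s})"
        unfolding submonoid_nat_def
      proof (intro conjI ballI)
        show "0 \<in> S - {s}" using s S by (auto simp: A_def max_ideal_def submonoid_nat_def)
        fix x y assume xy: "x \<in> S - {s}" "y \<in> S - {s}"
        then have "x + y \<in> S" using S by (auto simp: submonoid_nat_def)
        moreover have "x + y \<noteq> s"
        proof
          assume e: "x + y = s"
          then have "x \<noteq> 0" "y \<noteq> 0" using xy by auto
          then show False using e xy s by (auto simp: A_def max_ideal_def)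
        qed
        ultimately show "x + y \<in> S - {s}" by blast
      qed
      ultimately have "S \<subseteq> S - {s}" using G hull_minimal by metis
      then show False using s AS by blast
    qed
  qed
  show ?thesis
  proof (rule ex1I[of _ A])
    show "minimal_generators S A"
      using gen sub by (auto simp: minimal_generators_def)
    show "G = A" if "minimal_generators S G" for G
      using that gen sub unfolding minimal_generators_def by blast
  qed
qed

lemma numerical_semigroup_dilatation:
  assumes S: "numerical_semigroup S"
    and a: "int a \<in> int_diff (int ` max_ideal S) (int ` nfold_sumset 2 (max_ideal S))"
  shows "numerical_semigroup (dilatation S a)"
proof -
  have key: "x + y + a \<in> max_ideal S" if "x \<in> max_ideal S" "y \<in> max_ideal S" for x y
  proof -
    have "x + y \<in> nfold_sumset 2 (max_ideal S)"
      unfolding nfold_sumset_def using that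
      by (intro CollectI exI[of _ "\<lambda>i. if i = 0 then x else y"]) (auto simp: numeral_2_eq_2)
    then have "int a + int (x + y) \<in> int ` max_ideal S"
      using a unfolding int_diff_def by blast
    then obtain z where "z \<in> max_ideal S" "int a + int (x + y) = int z" by auto
    then show ?thesis by (metis add.commute of_nat_add of_nat_eq_iff)
  qed
  have "submonoid_nat (dilatation S a)"
    unfolding submonoid_nat_def
  proof (intro conjI ballI)
    fix x y assume xy: "x \<in> dilatation S a" "y \<in> dilatation S a"
    show "x + y \<in> dilatation S a"
    proof (cases "x = 0 \<or> y = 0")
      case False
      then obtain s t where "s \<in> max_ideal S" "t \<in> max_ideal S" "x = s + a" "y = t + a"
        using xy by (auto simp: dilatation_def)
      then have "x + y = (s + t + a) + a" "s + t + a \<in> max_ideal S" using key by auto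
      then show ?thesis unfolding dilatation_def by blast
    qed (use xy in auto)
  qed (auto simp: dilatation_def)
  moreover have "- dilatation S a \<subseteq> {..a} \<union> (\<lambda>s. s + a) ` (- S)"
  proof
    fix x assume x: "x \<in> - dilatation S a"
    show "x \<in> {..a} \<union> (\<lambda>s. s + a) ` (- S)"
    proof (cases "x \<le> a")
      case False
      then have "x = (x - a) + a" "x - a \<noteq> 0" by auto
      moreover from this x have "x - a \<notin> S" by (auto simp: dilatation_def max_ideal_def)
      ultimately show ?thesis by blast
    qed auto
  qed
  then have "finite (- dilatation S a)"
    using S by (auto simp: numerical_semigroup_def intro: finite_subset)
  ultimately show ?thesis by (simp add: numerical_semigroup_def)
qed

end

theory Submission
  imports Defs
begin

text \<open>Up to a translation, which changes no cardinality, passing from \<open>S\<close> to \<open>S + a\<close> replaces one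
  cofinite set \<open>X\<close> of naturals by \<open>X + a\<close>, and \<open>X + a\<close> misses exactly \<open>a\<close> more naturals than \<open>X\<close>
  does. For the type, \<open>M - M\<close> is the same for both semigroups and contains both \<open>S\<close> and
  \<open>S + a\<close>. For the Hilbert function, \<open>hM\<close> contains both \<open>(h + 1)M\<close> and \<open>(h + 1)M + a\<close>. These inclusions
  are where \<open>a \<in> M - 2M\<close> enters. The embedding dimension is the value of the Hilbert function at \<open>1\<close>.\<close>

section \<open>Complements and translates of sets of naturals\<close>

lemma Compl_image_add_nat:
  fixes a :: nat
  shows "- ((+) a ` X) = {..<a} \<union> (+) a ` (- X)"
proof -
  have "x \<in> {..<a} \<union> (+) a ` (- X)" if "x \<notin> (+) a ` X" for x
  proof (cases "x < a")
    case False
    then have "x = a + (x - a)" by simp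
    then show ?thesis using that by (metis ComplI UnI2 image_eqI)
  qed simp
  then show ?thesis by auto
qed

lemma finite_Compl_image_add_nat:
  fixes a :: nat
  assumes "finite (- X)"
  shows "finite (- ((+) a ` X))"
  using assms by (simp add: Compl_image_add_nat)

lemma card_Compl_image_add_nat:
  fixes a :: nat
  assumes "finite (- X)"
  shows "card (- ((+) a ` X)) = card (- X) + a"
proof -
  have "{..<a} \<inter> (+) a ` (- X) = {}" by auto
  then show ?thesis
    using assms by (simp add: Compl_image_add_nat card_Un_disjoint card_image)
qed

text \<open>The additive form avoids truncated subtraction: when two sets \<open>B\<close> are
  compared inside the same \<open>A\<close>, the term \<open>card (- A)\<close> cancels.\<close>

lemma card_Diff_cofinite:
  assumes "B \<subseteq> A" "finite (- B)"
  shows "card (A - B) + card (- A) = card (- B)"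
proof -
  have "- B = (A - B) \<union> - A" "(A - B) \<inter> - A = {}"
    using assms(1) by auto
  moreover have "finite (A - B)" "finite (- A)"
    using assms by (auto intro: finite_subset[OF _ assms(2)])
  ultimately show ?thesis by (metis card_Un_disjoint)
qed

section \<open>Iterated sumsets\<close>

lemma nfold_sumset_0: "nfold_sumset 0 A = {0}"
  by (auto simp: nfold_sumset_def)

text \<open>Turns the definition by families into a recursion on the number of summands, which
  carries the inductions below.\<close>

lemma nfold_sumset_Suc: "nfold_sumset (Suc h) A = {x + y | x y. x \<in> nfold_sumset h A \<and> y \<in> A}"
proof (intro subset_antisym subsetI)
  fix z assume "z \<in> nfold_sumset (Suc h) A"
  then obtain f where "z = (\<Sum>i<Suc h. f i)" "\<forall>i<Suc h. f i \<in> A"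
    unfolding nfold_sumset_def by blast
  then have "z = (\<Sum>i<h. f i) + f h" "(\<Sum>i<h. f i) \<in> nfold_sumset h A" "f h \<in> A"
    unfolding nfold_sumset_def by auto
  then show "z \<in> {x + y | x y. x \<in> nfold_sumset h A \<and> y \<in> A}" by blast
next
  fix z assume "z \<in> {x + y | x y. x \<in> nfold_sumset h A \<and> y \<in> A}"
  then obtain f y where "z = (\<Sum>i<h. f i) + y" "\<forall>i<h. f i \<in> A" "y \<in> A"
    unfolding nfold_sumset_def by blast
  then have "z = (\<Sum>i<Suc h. (f(h := y)) i)" "\<forall>i<Suc h. (f(h := y)) i \<in> A"
    by auto
  then show "z \<in> nfold_sumset (Suc h) A" unfolding nfold_sumset_def by blast
qed

lemma nfold_sumset_1: "nfold_sumset (Suc 0) A = A"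
  by (auto simp: nfold_sumset_Suc nfold_sumset_0)

lemma nfold_sumset_2: "nfold_sumset 2 A = {x + y | x y. x \<in> A \<and> y \<in> A}"
  by (simp add: numeral_2_eq_2 nfold_sumset_Suc[of "Suc 0"] nfold_sumset_1)

lemma nfold_sumset_image_add:
  "nfold_sumset h ((+) a ` A) = (+) (h * a) ` nfold_sumset h A"
proof (induction h)
  case (Suc h)
  have "nfold_sumset (Suc h) ((+) a ` A) =
      {(h * a + x) + (a + y) | x y. x \<in> nfold_sumset h A \<and> y \<in> A}"
    unfolding nfold_sumset_Suc[of h "(+) a ` A"] Suc.IH by blast
  also have "\<dots> = {Suc h * a + (x + y) | x y. x \<in> nfold_sumset h A \<and> y \<in> A}"
    by (simp add: algebra_simps)
  also have "\<dots> = (+) (Suc h * a) ` nfold_sumset (Suc h) A"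
    unfolding nfold_sumset_Suc by blast
  finally show ?case .
qed (simp add: nfold_sumset_0)

text \<open>For any \<open>m\<close> in \<open>A\<close>, the set (h + 1)A contains m + hA, and a
  translate of a cofinite set is cofinite. The induction starts at 1 because 0A = {0} is not
  cofinite.\<close>

lemma finite_Compl_nfold_sumset:
  assumes "finite (- A)" "h \<ge> 1"
  shows "finite (- nfold_sumset h A)"
  using assms(2)
proof (induction h rule: dec_induct)
  case base
  show ?case using assms(1) by (simp add: nfold_sumset_1)
next
  case (step h)
  obtain m where "m \<in> A"
    using assms(1) by (metis Compl_empty_eq equals0I infinite_UNIV_nat)
  then have "(+) m ` nfold_sumset h A \<subseteq> nfold_sumset (Suc h) A"
    unfolding nfold_sumset_Suc by (auto intro: add.commute)
  then show ?case
    using finite_Compl_image_add_nat[OF step.IH, of m] by (meson Compl_anti_mono finite_subset)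
qed

text \<open>The shift \<open>b\<close> merges two summands into one, and the remaining summands are
  carried along by associativity. The Hilbert function uses the cases \<open>b = 0\<close> and
  \<open>b = a\<close>.\<close>

lemma image_add_nfold_sumset_Suc_subset:
  assumes "\<And>x y. x \<in> A \<Longrightarrow> y \<in> A \<Longrightarrow> b + (x + y) \<in> A" "h \<ge> 1"
  shows "(+) b ` nfold_sumset (Suc h) A \<subseteq> nfold_sumset h A"
  using assms(2)
proof (induction h rule: dec_induct)
  case base
  show ?case
    using assms(1) by (auto simp: nfold_sumset_Suc[of "Suc 0"] nfold_sumset_1)
next
  case (step h)
  show ?case
  proof
    fix z assume "z \<in> (+) b ` nfold_sumset (Suc (Suc h)) A"
    then obtain x y where "z = b + (x + y)" "x \<in> nfold_sumset (Suc h) A" "y \<in> A"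
      unfolding nfold_sumset_Suc[of "Suc h"] by blast
    moreover from this have "b + x \<in> nfold_sumset h A" using step.IH by blast
    ultimately have "z = (b + x) + y \<and> b + x \<in> nfold_sumset h A \<and> y \<in> A" by simp
    then show "z \<in> nfold_sumset (Suc h) A" unfolding nfold_sumset_Suc by blast
  qed
qed

section \<open>The maximal ideal and minimal generators\<close>

lemma max_ideal_add:
  assumes "submonoid_nat S" "x \<in> max_ideal S" "y \<in> max_ideal S"
  shows "x + y \<in> max_ideal S"
  using assms by (auto simp: submonoid_nat_def max_ideal_def)

lemma finite_Compl_max_ideal:
  "numerical_semigroup S \<Longrightarrow> finite (- max_ideal S)"
  by (simp add: numerical_semigroup_def max_ideal_def Compl_Diff_eq)

text \<open>The elements outside 2M lie in every generating set and already generate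
  \<open>S\<close>. Hence they exhaust the minimal generating set \<open>G\<close>, whose existence
  is known.\<close>

lemma minimal_generators_max_ideal:
  assumes S: "submonoid_nat S"
  shows "minimal_generators S (max_ideal S - nfold_sumset 2 (max_ideal S))"
proof -
  let ?A = "max_ideal S - nfold_sumset 2 (max_ideal S)"
  obtain G where G: "minimal_generators S G" using ex1_minimal_generators[OF S] by blast
  then have hull_G: "submonoid_nat hull G = S" by (simp add: minimal_generators_def)
  then have GS: "G \<subseteq> S" using hull_subset by metis
  have AG: "?A \<subseteq> G"
  proof
    fix s assume s: "s \<in> ?A"
    show "s \<in> G"
    proof (rule ccontr)
      assume "s \<notin> G"
      \<comment> \<open>A sum of two nonzero elements lies in 2M and so differs from
        \<open>s\<close>; deleting \<open>s\<close> therefore leaves a submonoid, which still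
        contains \<open>G\<close>.\<close>
      have "x + y \<in> S - {s}" if "x \<in> S - {s}" "y \<in> S - {s}" for x y
      proof (cases "x = 0 \<or> y = 0")
        case False
        then have "x + y \<in> nfold_sumset 2 (max_ideal S)"
          using that unfolding nfold_sumset_2 max_ideal_def by blast
        then show ?thesis using s S that by (auto simp: submonoid_nat_def)
      qed (use that in auto)
      then have "submonoid_nat (S - {s})"
        using S s by (auto simp: submonoid_nat_def max_ideal_def)
      then have "S \<subseteq> S - {s}"
        using hull_minimal[of G "S - {s}" submonoid_nat] hull_G GS \<open>s \<notin> G\<close> by blast
      then show False using s by (auto simp: max_ideal_def)
    qed
  qed
  have closed: "submonoid_nat (submonoid_nat hull ?A)" by (rule submonoid_nat_hull)
  have "s \<in> submonoid_nat hull ?A" if "s \<in> S" for s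
    using that
  proof (induction s rule: less_induct)
    case (less s)
    consider "s = 0" | "s \<in> ?A"
      | x y where "x \<in> max_ideal S" "y \<in> max_ideal S" "s = x + y"
      using less.prems unfolding nfold_sumset_2 max_ideal_def by blast
    then show ?case
    proof cases
      case 1
      then show ?thesis using closed unfolding submonoid_nat_def[of "_ hull _"] by blast
    next
      case 2
      then show ?thesis by (rule hull_inc)
    next
      case 3
      \<comment> \<open>Both summands are nonzero, hence smaller than \<open>s\<close>.\<close>
      then have "x \<in> submonoid_nat hull ?A" "y \<in> submonoid_nat hull ?A"
        using less.IH[of x] less.IH[of y] by (auto simp: max_ideal_def)
      then show ?thesis using closed 3(3) unfolding submonoid_nat_def[of "_ hull _"] by blast
    qed
  qed
  moreover have "submonoid_nat hull ?A \<subseteq> S"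
    using S by (intro hull_minimal) (auto simp: max_ideal_def)
  ultimately have "submonoid_nat hull ?A = S" by blast
  then have "?A = G" using AG G unfolding minimal_generators_def by blast
  then show ?thesis using G by simp
qed

text \<open>Both sides count M without 2M.\<close>

lemma embedding_dimension_eq_hilbert_function:
  assumes "submonoid_nat S"
  shows "embedding_dimension S = hilbert_function S 1"
  using the1_equality[OF ex1_minimal_generators minimal_generators_max_ideal, OF assms assms]
  by (simp add: embedding_dimension_def hilbert_function_def nfold_sumset_1 flip: numeral_2_eq_2)

section \<open>Differences of sets of integers, brought back to the naturals\<close>

text \<open>A negative \<open>z\<close> is ruled out because \<open>z + min A\<close> would lie below \<open>min A\<close>.\<close>

lemma int_diff_self:
  assumes "A \<noteq> {}"
  shows "int_diff (int ` A) (int ` A) = int ` {z. (+) z ` A \<subseteq> A}"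
proof (intro subset_antisym subsetI)
  fix z assume z: "z \<in> int_diff (int ` A) (int ` A)"
  define m where "m = (LEAST m. m \<in> A)"
  have "m \<in> A" using assms unfolding m_def by (metis LeastI ex_in_conv)
  then have "z + int m \<in> int ` A" using z by (auto simp: int_diff_def)
  then obtain k where "k \<in> A" "z + int m = int k" by auto
  moreover have "m \<le> k" using \<open>k \<in> A\<close> unfolding m_def by (rule Least_le)
  ultimately have zk: "z = int (k - m)" by simp
  have "k - m + x \<in> A" if "x \<in> A" for x
  proof -
    have "z + int x \<in> int ` A" using z that by (auto simp: int_diff_def)
    then have "int (k - m + x) \<in> int ` A" by (simp only: zk of_nat_add)
    then show ?thesis by (metis image_iff of_nat_eq_iff)
  qed
  then show "z \<in> int ` {z. (+) z ` A \<subseteq> A}" using zk by blast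
next
  fix z assume "z \<in> int ` {z. (+) z ` A \<subseteq> A}"
  then obtain n where n: "z = int n" "(+) n ` A \<subseteq> A" by auto
  have "int n + int x \<in> int ` A" if "x \<in> A" for x
    using n(2) that by (metis image_eqI image_subset_iff of_nat_add)
  then show "z \<in> int_diff (int ` A) (int ` A)" by (auto simp: int_diff_def n(1))
qed

lemma semigroup_type_eq:
  assumes "max_ideal S \<noteq> {}"
  shows "semigroup_type S = card ({z. (+) z ` max_ideal S \<subseteq> max_ideal S} - S)"
  unfolding semigroup_type_def int_diff_self[OF assms]
  by (simp add: card_image flip: image_set_diff[OF inj_of_nat])

lemma int_diff_2_add:
  assumes "int a \<in> int_diff (int ` A) (int ` nfold_sumset 2 A)" "x \<in> A" "y \<in> A"
  shows "a + (x + y) \<in> A"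
proof -
  have "x + y \<in> nfold_sumset 2 A" using assms(2,3) unfolding nfold_sumset_2 by blast
  then have "int a + int (x + y) \<in> int ` A"
    using assms(1) unfolding int_diff_def by blast
  then have "int (a + (x + y)) \<in> int ` A" by (simp only: of_nat_add)
  then show ?thesis by (metis image_iff of_nat_eq_iff)
qed

section \<open>Invariants of the dilatation\<close>

lemma dilatation_eq: "dilatation S a = insert 0 ((+) a ` max_ideal S)"
  by (auto simp: dilatation_def add.commute)

lemma max_ideal_dilatation: "max_ideal (dilatation S a) = (+) a ` max_ideal S"
  by (auto simp: dilatation_eq max_ideal_def)

lemma Compl_dilatation:
  assumes "0 \<in> S"
  shows "- dilatation S a = {1..a} \<union> (+) a ` (- S)"
proof -
  \<comment> \<open>The 0 missing from M is translated to the gap \<open>a\<close>, while 0 itself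
    belongs to the dilatation: the gaps below \<open>a\<close> thus become 1, ..., a.\<close>
  have "- max_ideal S = insert 0 (- S)" by (auto simp: max_ideal_def)
  then have "- dilatation S a = ({..<a} \<union> (+) a ` insert 0 (- S)) - {0}"
    using Compl_image_add_nat[of a "max_ideal S"] by (auto simp: dilatation_eq)
  also have "\<dots> = {1..a} \<union> (+) a ` (- S)"
  proof -
    have "0 \<notin> (+) a ` (- S)" using assms by auto
    moreover have "{..<a} \<union> {a} - {0} = {1..a}" by auto
    ultimately show ?thesis by auto
  qed
  finally show ?thesis .
qed

lemma genus_dilatation:
  assumes "numerical_semigroup S"
  shows "genus (dilatation S a) = genus S + a"
proof -
  have S: "0 \<in> S" "finite (- S)"
    using assms by (auto simp: numerical_semigroup_def submonoid_nat_def)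
  \<comment> \<open>Gaps of \<open>S\<close> are positive, so their translates exceed
    \<open>a\<close> and avoid the new gaps.\<close>
  have "x \<noteq> 0" if "x \<in> - S" for x using that S(1) by (metis ComplD)
  then have "{1..a} \<inter> (+) a ` (- S) = {}" by fastforce
  then show ?thesis
    using S by (simp add: genus_def Compl_dilatation card_Un_disjoint card_image)
qed

lemma frobenius_number_dilatation:
  assumes "numerical_semigroup S" "S \<noteq> UNIV"
  shows "frobenius_number (dilatation S a) = frobenius_number S + a"
proof -
  have S: "0 \<in> S" "finite (- S)" "- S \<noteq> {}"
    using assms by (auto simp: numerical_semigroup_def submonoid_nat_def)
  have F: "frobenius_number S \<in> - S"
    unfolding frobenius_number_def using S by (intro Max_in)
  have le: "x \<le> frobenius_number S" if "x \<in> - S" for x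
    unfolding frobenius_number_def using S that by (intro Max_ge)
  show ?thesis
    unfolding frobenius_number_def[of "dilatation S a"] Compl_dilatation[OF S(1)]
  proof (rule Max_eqI)
    show "x \<le> frobenius_number S + a" if "x \<in> {1..a} \<union> (+) a ` (- S)" for x
      using that le by auto
    show "frobenius_number S + a \<in> {1..a} \<union> (+) a ` (- S)"
      using F by (auto simp: add.commute)
  qed (use S in auto)
qed

lemma semigroup_multiplicity_dilatation:
  assumes "max_ideal S \<noteq> {}"
  shows "semigroup_multiplicity (dilatation S a) = semigroup_multiplicity S + a"
proof -
  have "semigroup_multiplicity S \<in> max_ideal S"
    using assms unfolding semigroup_multiplicity_def by (metis LeastI ex_in_conv)
  moreover have "semigroup_multiplicity S \<le> x" if "x \<in> max_ideal S" for x
    using that unfolding semigroup_multiplicity_def by (rule Least_le)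
  ultimately show ?thesis
    unfolding semigroup_multiplicity_def[of "dilatation S a"] max_ideal_dilatation
    by (intro Least_equality) auto
qed

lemma num_sporadic_dilatation:
  assumes "numerical_semigroup S" "S \<noteq> UNIV"
  shows "num_sporadic (dilatation S a) = num_sporadic S"
proof -
  let ?F = "frobenius_number S" and ?M = "max_ideal S"
  have "0 \<in> S" using assms(1) by (simp add: numerical_semigroup_def submonoid_nat_def)
  \<comment> \<open>0 is split off because it is the only element that the dilatation does not
    translate.\<close>
  then have "S \<inter> {0..?F} = insert 0 (?M \<inter> {0..?F})" by (auto simp: max_ideal_def)
  moreover have "dilatation S a \<inter> {0..?F + a} = insert 0 ((+) a ` (?M \<inter> {0..?F}))"
    by (auto simp: dilatation_eq)
  moreover have "0 \<notin> ?M \<inter> {0..?F}" "0 \<notin> (+) a ` (?M \<inter> {0..?F})"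
    by (auto simp: max_ideal_def)
  ultimately show ?thesis
    by (simp add: num_sporadic_def frobenius_number_dilatation[OF assms] card_image)
qed

text \<open>Both types equal the genus minus the number of naturals outside the common set
  \<open>?D\<close>, so they differ exactly as the genera do.\<close>

lemma semigroup_type_dilatation:
  assumes S: "numerical_semigroup S"
    and a: "int a \<in> int_diff (int ` max_ideal S) (int ` nfold_sumset 2 (max_ideal S))"
  shows "semigroup_type (dilatation S a) = semigroup_type S + a"
proof -
  let ?M = "max_ideal S" and ?T = "dilatation S a"
  let ?D = "{z. (+) z ` ?M \<subseteq> ?M}"
  have sub: "submonoid_nat S" using S by (simp add: numerical_semigroup_def)
  have ne: "?M \<noteq> {}" using finite_Compl_max_ideal[OF S] by auto
  have "(+) z ` (+) a ` ?M = (+) a ` (+) z ` ?M" for z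
    by (simp add: image_image add.left_commute)
  then have "{z. (+) z ` max_ideal ?T \<subseteq> max_ideal ?T} = ?D"
    by (simp add: max_ideal_dilatation inj_image_subset_iff)
  then have tT: "semigroup_type ?T = card (?D - ?T)"
    using semigroup_type_eq[of ?T] ne by (simp add: max_ideal_dilatation)
  have "?M \<subseteq> ?D" using max_ideal_add[OF sub] by blast
  moreover have "S \<subseteq> insert 0 ?M" "0 \<in> ?D" by (auto simp: max_ideal_def)
  ultimately have "S \<subseteq> ?D" by blast
  then have "semigroup_type S + card (- ?D) = genus S"
    using card_Diff_cofinite[of S ?D] S
    by (simp add: semigroup_type_eq[OF ne] genus_def numerical_semigroup_def)
  \<comment> \<open>An element a + m maps each m' in M to a + (m + m'), which lies in M by the
    hypothesis on \<open>a\<close>.\<close>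
  moreover have "(+) a ` ?M \<subseteq> ?D" using int_diff_2_add[OF a] by (auto simp: add.assoc)
  then have "?T \<subseteq> ?D" by (auto simp: dilatation_eq)
  then have "semigroup_type ?T + card (- ?D) = genus ?T"
    using card_Diff_cofinite[of ?T ?D] numerical_semigroup_dilatation[OF S a]
    by (simp add: tT genus_def numerical_semigroup_def)
  ultimately show ?thesis using genus_dilatation[OF S, of a] by linarith
qed

lemma hilbert_function_dilatation:
  assumes S: "numerical_semigroup S"
    and a: "int a \<in> int_diff (int ` max_ideal S) (int ` nfold_sumset 2 (max_ideal S))"
    and h: "h \<ge> 1"
  shows "hilbert_function (dilatation S a) h = hilbert_function S h + a"
proof -
  let ?M = "max_ideal S"
  let ?A = "nfold_sumset h ?M" and ?B = "nfold_sumset (Suc h) ?M"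
  have sub: "submonoid_nat S" using S by (simp add: numerical_semigroup_def)
  have finB: "finite (- ?B)"
    using finite_Compl_max_ideal[OF S] by (rule finite_Compl_nfold_sumset) simp
  have BA: "?B \<subseteq> ?A"
    using image_add_nfold_sumset_Suc_subset[of ?M 0 h] max_ideal_add[OF sub] h by simp
  have aBA: "(+) a ` ?B \<subseteq> ?A"
    using int_diff_2_add[OF a] h by (rule image_add_nfold_sumset_Suc_subset)
  \<comment> \<open>One summand more than in h(M + a) means one \<open>a\<close> more: after the
    common translation by \<open>h * a\<close> is removed, (h + 1)M is still shifted by
    \<open>a\<close>.\<close>
  have "nfold_sumset (Suc h) ((+) a ` ?M) = (+) (h * a) ` (+) a ` ?B"
    by (simp add: nfold_sumset_image_add image_image add.left_commute add.assoc)
  then have "hilbert_function (dilatation S a) h = card ((+) (h * a) ` (?A - (+) a ` ?B))"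
    by (simp add: hilbert_function_def max_ideal_dilatation nfold_sumset_image_add[of h]
        image_set_diff)
  then have "hilbert_function (dilatation S a) h = card (?A - (+) a ` ?B)"
    by (simp add: card_image)
  then have "hilbert_function (dilatation S a) h + card (- ?A) = card (- ?B) + a"
    using card_Diff_cofinite[OF aBA finite_Compl_image_add_nat[OF finB]]
    by (simp add: card_Compl_image_add_nat[OF finB])
  moreover have "hilbert_function S h + card (- ?A) = card (- ?B)"
    using card_Diff_cofinite[OF BA finB] by (simp add: hilbert_function_def)
  ultimately show ?thesis by linarith
qed

theorem proposition2p1:
  fixes S T :: "nat set" and a :: nat
  assumes "numerical_semigroup S"
    and "S \<noteq> UNIV"
    and "int a \<in> int_diff (int ` max_ideal S) (int ` nfold_sumset 2 (max_ideal S))"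
    and "T = dilatation S a"
  shows "frobenius_number T = frobenius_number S + a
    \<and> genus T = genus S + a
    \<and> semigroup_multiplicity T = semigroup_multiplicity S + a
    \<and> num_sporadic T = num_sporadic S
    \<and> semigroup_type T = semigroup_type S + a
    \<and> (\<forall>h\<ge>1. hilbert_function T h = hilbert_function S h + a)
    \<and> embedding_dimension T = embedding_dimension S + a"
proof -
  have "max_ideal S \<noteq> {}" using finite_Compl_max_ideal[OF assms(1)] by auto
  \<comment> \<open>Closure of \<open>T\<close> is what allows its embedding dimension to be read
    off as the value of its Hilbert function at 1.\<close>
  moreover have "submonoid_nat S" "submonoid_nat T"
    using assms(1) numerical_semigroup_dilatation[OF assms(1,3)] assms(4)
    by (auto simp: numerical_semigroup_def)
  ultimately show ?thesis
    using assms(1-3) unfolding assms(4)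
    by (simp add: frobenius_number_dilatation genus_dilatation semigroup_multiplicity_dilatation
        num_sporadic_dilatation semigroup_type_dilatation hilbert_function_dilatation
        embedding_dimension_eq_hilbert_function)
qed

end
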